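(* Let $\mathcal H$ be a separable Hilbert space, let $K\in\mathcal L(\mathcal H)$ have closed range, and let $\mathcal W_v=\{(\mathcal W_i,v_i)\}_{i\in I}$ be a $K$-fusion frame for $\mathcal H$ with bounds $A$ and $B$. Suppose $J\subseteq I$ is such that $\sum_{i\in J}v_i^2=C<\infty$ and $A-C\|K^{\dagger}\|^2>0$. Then $\{(\mathcal W_i,v_i)\}_{i\in I\setminus J}$ is a $K$-fusion frame for $R(K)$ with bounds $A-C\|K^{\dagger}\|^2$ and $B$.
   Context: $\mathcal L(\mathcal H)$ is the space of bounded linear operators on $\mathcal H$; $R(K)$ is the range of $K$. The index set $I$ is finite or countable. For a closed subspace $\mathcal W$, $P_{\mathcal W}$ denotes the orthogonal projection onto $\mathcal W$. For an operator $K$ with closed range, $K^{\dagger}$ denotes its Moore–Penrose pseudo-inverse. A weighted collection of closed subspaces $\mathcal W_v=\{(\mathcal W_i,v_i)\}_{i\in I}$ consists of closed subspaces $\mathcal W_i$ of $\mathcal H$ and real scalars $v_i$. It is a $K$-fusion frame for $\mathcal H$ with bounds $A,B>0$ if $A\|K^*f\|^2\le\sum_{i\in I}v_i^2\|P_{\mathcal W_i}f\|^2\le B\|f\|^2$ for all $f\in\mathcal H$. A collection of closed subspaces of $\mathcal H$ is called a $K$-fusion frame for $R(K)$ with bounds $A',B'>0$ if the inequalities $A'\|K^*f\|^2\le\sum_i v_i^2\|P_{\mathcal W_i}f\|^2\le B'\|f\|^2$ (sum over the index set of the collection) hold for all $f\in R(K)$. *)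

theory Defs
  imports "HOL-Analysis.Analysis"
begin

text \<open>
  A Hilbert space may be real or complex.  The class below captures exactly these two scalar
  fields: by the Gelfand--Mazur theorem a real normed field (whose norm is multiplicative) is
  \<open>\<real>\<close> or \<open>\<complex>\<close>, and the last axiom forces \<open>hconj\<close> to be the usual conjugation.
\<close>

class hilbert_scalar = real_normed_field +
  fixes hconj :: "'a \<Rightarrow> 'a"
  assumes hconj_add: "hconj (a + b) = hconj a + hconj b"
    and hconj_mult: "hconj (a * b) = hconj a * hconj b"
    and hconj_hconj: "hconj (hconj a) = a"
    and mult_hconj: "a * hconj a = (norm a)\<^sup>2 *\<^sub>R 1"

instantiation real :: hilbert_scalar
begin
definition hconj_real :: "real \<Rightarrow> real" where "hconj_real a = a"
instance by standard (simp_all add: hconj_real_def power2_eq_square)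
end

instantiation complex :: hilbert_scalar
begin
definition hconj_complex :: "complex \<Rightarrow> complex" where "hconj_complex a = cnj a"
instance by standard (simp_all add: hconj_complex_def scaleR_conv_of_real flip: complex_norm_square)
end

text \<open>
  A Hilbert space over \<open>'k\<close>, carried by a whole type: the topology and the completeness come from
  the class \<^class>\<open>banach\<close>, and the norm is tied to the inner product \<open>ip\<close>, which is linear in its
  first argument.
\<close>

locale hilbert_space = vector_space scl
  for scl :: "'k::hilbert_scalar \<Rightarrow> 'h::banach \<Rightarrow> 'h" +
  fixes ip :: "'h \<Rightarrow> 'h \<Rightarrow> 'k"
  assumes smult_of_real: "scl (of_real r) x = r *\<^sub>R x"
    and ip_add_left: "ip (x + y) z = ip x z + ip y z"
    and ip_smult_left: "ip (scl c x) y = c * ip x y"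
    and ip_commute: "ip y x = hconj (ip x y)"
    and ip_self: "ip x x = of_real ((norm x)\<^sup>2)"

lemma hilbert_space_real:
  "hilbert_space (*\<^sub>R) (inner :: 'h::{real_inner,banach} \<Rightarrow> 'h \<Rightarrow> real)"
  by unfold_locales
    (simp_all add: hconj_real_def inner_add_left inner_commute power2_norm_eq_inner algebra_simps)

lemma hilbert_space_complex: "hilbert_space (*) (\<lambda>x y :: complex. x * cnj y)"
  by unfold_locales
    (simp_all add: hconj_complex_def scaleR_conv_of_real algebra_simps flip: complex_norm_square)

definition bounded_operator :: "('k::hilbert_scalar \<Rightarrow> 'h::banach \<Rightarrow> 'h) \<Rightarrow> ('h \<Rightarrow> 'h) \<Rightarrow> bool" where
  "bounded_operator scl T \<longleftrightarrow>
     bounded_linear T \<and> (\<forall>c x. T (scl c x) = scl c (T x))"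

definition closed_subspace :: "('k::hilbert_scalar \<Rightarrow> 'h::banach \<Rightarrow> 'h) \<Rightarrow> 'h set \<Rightarrow> bool" where
  "closed_subspace scl W \<longleftrightarrow> module.subspace scl W \<and> closed W"

definition hadjoint :: "('h::banach \<Rightarrow> 'h \<Rightarrow> 'k::hilbert_scalar) \<Rightarrow> ('h \<Rightarrow> 'h) \<Rightarrow> 'h \<Rightarrow> 'h" where
  "hadjoint ip T = (THE S. \<forall>x y. ip (T x) y = ip x (S y))"

definition orth_proj :: "('h::banach \<Rightarrow> 'h \<Rightarrow> 'k::hilbert_scalar) \<Rightarrow> 'h set \<Rightarrow> 'h \<Rightarrow> 'h" where
  "orth_proj ip W f = (THE g. g \<in> W \<and> (\<forall>w\<in>W. ip (f - g) w = 0))"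

text \<open>
  The four Penrose equations; for a bounded operator with closed range they have exactly one
  bounded solution.
\<close>

definition pseudo_inverse ::
  "('k::hilbert_scalar \<Rightarrow> 'h::banach \<Rightarrow> 'h) \<Rightarrow> ('h \<Rightarrow> 'h \<Rightarrow> 'k) \<Rightarrow> ('h \<Rightarrow> 'h) \<Rightarrow> 'h \<Rightarrow> 'h" where
  "pseudo_inverse scl ip T =
     (THE X. bounded_operator scl X \<and>
        T \<circ> X \<circ> T = T \<and> X \<circ> T \<circ> X = X \<and>
        hadjoint ip (T \<circ> X) = T \<circ> X \<and> hadjoint ip (X \<circ> T) = X \<circ> T)"

text \<open>
  \<open>S\<close> is the set of vectors on which the inequalities are required: the whole space for a
  \<open>K\<close>-fusion frame for \<open>\<H>\<close>, and \<open>range K\<close> for a \<open>K\<close>-fusion frame for \<open>R(K)\<close>.  Summability is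
  stated explicitly because \<^const>\<open>infsum\<close> is \<open>0\<close> on families that are not summable.
\<close>

definition K_fusion_frame_on ::
  "('k::hilbert_scalar \<Rightarrow> 'h::banach \<Rightarrow> 'h) \<Rightarrow> ('h \<Rightarrow> 'h \<Rightarrow> 'k) \<Rightarrow> ('h \<Rightarrow> 'h) \<Rightarrow> 'h set \<Rightarrow>
   'i set \<Rightarrow> ('i \<Rightarrow> 'h set) \<Rightarrow> ('i \<Rightarrow> real) \<Rightarrow> real \<Rightarrow> real \<Rightarrow> bool" where
  "K_fusion_frame_on scl ip K S I W v A B \<longleftrightarrow>
     0 < A \<and> 0 < B \<and>
     (\<forall>i\<in>I. closed_subspace scl (W i)) \<and>
     (\<forall>f\<in>S. (\<lambda>i. (v i)\<^sup>2 * (norm (orth_proj ip (W i) f))\<^sup>2) summable_on I \<and>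
        A * (norm (hadjoint ip K f))\<^sup>2 \<le> (\<Sum>\<^sub>\<infinity>i\<in>I. (v i)\<^sup>2 * (norm (orth_proj ip (W i) f))\<^sup>2) \<and>
        (\<Sum>\<^sub>\<infinity>i\<in>I. (v i)\<^sup>2 * (norm (orth_proj ip (W i) f))\<^sup>2) \<le> B * (norm f)\<^sup>2)"

end

theory Submission
  imports Defs
begin

text \<open>
  Let \<open>f\<close> be in the range of \<open>K\<close> and write \<open>X\<close> for the pseudo-inverse.  Since \<open>K (X f) = f\<close>,
  \<open>\<parallel>f\<parallel>\<^sup>2 = \<langle>K (X f), f\<rangle> = \<langle>X f, K\<^sup>* f\<rangle> \<le> \<parallel>X\<parallel> \<parallel>f\<parallel> \<parallel>K\<^sup>* f\<parallel>\<close>, so that \<open>\<parallel>f\<parallel> \<le> \<parallel>X\<parallel> \<parallel>K\<^sup>* f\<parallel>\<close> on the range of \<open>K\<close> (\<open>norm_le_pseudo_inverse_hadjoint\<close>).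
  Orthogonal projections do not increase norms, hence deleting the indices in \<open>J\<close> costs the frame
  sum at most \<open>C \<parallel>f\<parallel>\<^sup>2 \<le> C \<parallel>X\<parallel>\<^sup>2 \<parallel>K\<^sup>* f\<parallel>\<^sup>2\<close>, which is the amount by which the lower bound drops.
  The upper bound survives because only nonnegative terms are deleted.

  Most of the work is to show that the adjoint, the orthogonal projections and the pseudo-inverse,
  which are given by definite descriptions, exist and are unique, uniformly over real and complex
  scalars.  Projections come from the parallelogram law and completeness (\<open>ex_orth_proj\<close>),
  adjoints from the Riesz representation theorem.

  The pseudo-inverse \<open>X\<close> of an operator \<open>T\<close> with closed range is obtained as \<open>T\<^sup>* S\<^sup>-\<^sup>1 P\<close>, where
  \<open>P\<close> is the projection onto the range of \<open>T\<close> and \<open>S\<close> is the restriction of \<open>T T\<^sup>*\<close> to that range.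
  That \<open>S\<close> is invertible follows in two steps.  The uniform boundedness principle shows
  that \<open>T\<^sup>*\<close> is bounded below on the range of \<open>T\<close> (\<open>norm_le_hadjoint_on_closed_range\<close>).  Then
  \<open>\<langle>T T\<^sup>* f, f\<rangle> = \<parallel>T\<^sup>* f\<parallel>\<^sup>2\<close> makes \<open>S\<close> coercive, and a coercive operator is onto, as in the
  Lax--Milgram theorem (\<open>range_operator_hadjoint_on_closed_range\<close>).
\<close>

section \<open>Inner products\<close>

lemma hconj_0 [simp]: "hconj (0 :: 'k::hilbert_scalar) = 0"
  using hconj_add[of "0 :: 'k" 0] by simp

context hilbert_space
begin

lemma ip_add_right: "ip x (y + z) = ip x y + ip x z"
  by (metis ip_add_left ip_commute hconj_add)

lemma ip_smult_right: "ip x (scl c y) = hconj c * ip x y"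
  by (metis ip_smult_left ip_commute hconj_mult)

lemma ip_0_left [simp]: "ip 0 y = 0"
  using ip_add_left[of 0 0 y] by simp

lemma ip_0_right [simp]: "ip x 0 = 0"
  using ip_add_right[of x 0 0] by simp

lemma ip_minus_left: "ip (- x) y = - ip x y"
  using ip_add_left[of x "- x" y] by (simp add: eq_neg_iff_add_eq_0 add.commute)

lemma ip_minus_right: "ip x (- y) = - ip x y"
  using ip_add_right[of x y "- y"] by (simp add: eq_neg_iff_add_eq_0 add.commute)

lemma ip_diff_left: "ip (x - y) z = ip x z - ip y z"
  using ip_add_left[of x "- y" z] by (simp add: ip_minus_left)

lemma ip_diff_right: "ip x (y - z) = ip x y - ip x z"
  using ip_add_right[of x y "- z"] by (simp add: ip_minus_right)

lemma ip_scaleR_left: "ip (r *\<^sub>R x) y = of_real r * ip x y"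
  by (metis ip_smult_left smult_of_real)

lemma ip_zero_commute: "ip x y = 0 \<Longrightarrow> ip y x = 0"
  by (metis ip_commute hconj_0)

lemma ip_self_eq_0: "ip x x = 0 \<Longrightarrow> x = 0"
  by (simp add: ip_self)

lemma norm_ip_self:
  fixes x :: 'h
  shows "norm (ip x x) = (norm x)\<^sup>2"
  by (simp add: ip_self del: of_real_power)

lemma parallelogram:
  fixes x y :: 'h
  shows "(norm (x + y))\<^sup>2 + (norm (x - y))\<^sup>2 = 2 * (norm x)\<^sup>2 + 2 * (norm y)\<^sup>2"
proof -
  have "of_real ((norm (x + y))\<^sup>2 + (norm (x - y))\<^sup>2) = ip (x + y) (x + y) + ip (x - y) (x - y)"
    by (simp add: ip_self)
  also have "\<dots> = 2 * ip x x + 2 * ip y y"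
    by (simp add: ip_add_left ip_add_right ip_diff_left ip_diff_right)
  also have "\<dots> = of_real (2 * (norm x)\<^sup>2 + 2 * (norm y)\<^sup>2)"
    by (simp add: ip_self)
  finally show ?thesis
    by (simp only: of_real_eq_iff)
qed

text \<open>
  This is Pythagoras for the component of \<open>x\<close> along \<open>w\<close>.  Nonnegativity of the left-hand side is
  the Cauchy--Schwarz inequality; and if subtracting multiples of \<open>w\<close> cannot shorten \<open>x\<close>, then
  \<open>x\<close> is orthogonal to \<open>w\<close>.
\<close>

lemma norm_subtract_component:
  assumes "w \<noteq> 0"
  shows "(norm (x - scl (ip x w / of_real ((norm w)\<^sup>2)) w))\<^sup>2 = (norm x)\<^sup>2 - (norm (ip x w))\<^sup>2 / (norm w)\<^sup>2"
    (is "(norm (x - scl ?c w))\<^sup>2 = _")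
proof -
  let ?n = "of_real ((norm w)\<^sup>2) :: 'k"
  have n: "?n \<noteq> 0" using assms by simp
  have cn: "?c * ?n = ip x w" using n by (simp del: of_real_power)
  have h: "ip x w * ip w x = of_real ((norm (ip x w))\<^sup>2)"
    using mult_hconj[of "ip x w"] by (simp add: scaleR_conv_of_real flip: ip_commute)
  have "of_real ((norm (x - scl ?c w))\<^sup>2) = ip (x - scl ?c w) (x - scl ?c w)"
    by (simp add: ip_self)
  also have "\<dots> = ip x x - hconj ?c * ip x w - ?c * ip w x + hconj ?c * (?c * ip w w)"
    by (simp add: ip_diff_left ip_diff_right ip_smult_left ip_smult_right algebra_simps)
  also have "\<dots> = ip x x - ?c * ip w x"
    using cn by (simp add: ip_self)
  also have "?c * ip w x = of_real ((norm (ip x w))\<^sup>2 / (norm w)\<^sup>2)"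
    using h by (simp add: divide_simps)
  also have "ip x x - \<dots> = of_real ((norm x)\<^sup>2 - (norm (ip x w))\<^sup>2 / (norm w)\<^sup>2)"
    by (simp add: ip_self)
  finally show ?thesis
    by (simp only: of_real_eq_iff)
qed

lemma Cauchy_Schwarz: "norm (ip x y) \<le> norm x * norm y"
proof (cases "y = 0")
  case False
  have "0 \<le> (norm x)\<^sup>2 - (norm (ip x y))\<^sup>2 / (norm y)\<^sup>2"
    by (metis norm_subtract_component[OF False] zero_le_power2)
  then have "(norm (ip x y))\<^sup>2 \<le> (norm x * norm y)\<^sup>2"
    using False by (simp add: field_simps power_mult_distrib)
  then show ?thesis
    by (rule power2_le_imp_le) simp
qed simp

lemma bounded_linear_ip_left: "bounded_linear (\<lambda>x. ip x y)"
  by (rule bounded_linear_intro[of _ "norm y"])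
    (simp_all add: ip_add_left ip_scaleR_left scaleR_conv_of_real Cauchy_Schwarz)

section \<open>Orthogonal projections\<close>

lemma subspace_scaleR: "subspace S \<Longrightarrow> x \<in> S \<Longrightarrow> r *\<^sub>R x \<in> S"
  by (metis subspace_scale smult_of_real)

text \<open>
  By the parallelogram law, the sets of almost best approximations to \<open>f\<close> in \<open>W\<close> are closed, nested
  and of diameter tending to zero, so by completeness they have a common point, a best
  approximation \<open>g\<close>.  Minimality of \<open>f - g\<close> forces it to be orthogonal to \<open>W\<close>.
\<close>

lemma ex_orth_proj:
  assumes "closed_subspace scl W"
  shows "\<exists>g\<in>W. \<forall>w\<in>W. ip (f - g) w = 0"
proof -
  have sub: "subspace W" and "closed W"
    using assms by (auto simp: closed_subspace_def)
  have "W \<noteq> {}" using subspace_0[OF sub] by auto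
  define d where "d = infdist f W"
  have d: "d \<le> norm (f - w)" if "w \<in> W" for w
    using infdist_le[OF that, of f] by (simp add: d_def dist_norm)
  have "d \<ge> 0" by (simp add: d_def infdist_nonneg)
  define F where "F n = {w \<in> W. (norm (f - w))\<^sup>2 \<le> d\<^sup>2 + inverse (Suc n)}" for n
  \<comment> \<open>the midpoint of two points of \<open>F n\<close> is at distance at least \<open>d\<close> from \<open>f\<close>\<close>
  have close: "(dist w w')\<^sup>2 \<le> 4 * inverse (Suc n)" if "w \<in> F n" "w' \<in> F n" for n w w'
  proof -
    have "(1/2) *\<^sub>R (w + w') \<in> W"
      using that sub by (intro subspace_scaleR subspace_add) (auto simp: F_def)
    then have "d\<^sup>2 \<le> (norm (f - (1/2) *\<^sub>R (w + w')))\<^sup>2"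
      by (intro power_mono d \<open>d \<ge> 0\<close>)
    moreover have "(f - w) + (f - w') = 2 *\<^sub>R (f - (1/2) *\<^sub>R (w + w'))"
      by (simp add: algebra_simps flip: scaleR_2)
    then have "(norm ((f - w) + (f - w')))\<^sup>2 = 4 * (norm (f - (1/2) *\<^sub>R (w + w')))\<^sup>2"
      by (simp add: power_mult_distrib)
    moreover have "(norm ((f - w) - (f - w'))) = dist w w'"
      by (simp add: dist_norm norm_minus_commute)
    ultimately show ?thesis
      using parallelogram[of "f - w" "f - w'"] that unfolding F_def by auto
  qed
  obtain g where g: "g \<in> F n" for n
  proof (rule decreasing_closed_nest[of F])
    show "closed (F n)" for n
      unfolding F_def using \<open>closed W\<close>
      by (intro closed_Collect_conj closed_Collect_le continuous_intros) simp_all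
    show "F n \<noteq> {}" for n
    proof -
      have "d < sqrt (d\<^sup>2 + inverse (Suc n))"
        by (rule real_less_rsqrt) simp
      then obtain w where "w \<in> W" "dist f w < sqrt (d\<^sup>2 + inverse (Suc n))"
        unfolding d_def using \<open>W \<noteq> {}\<close>
        by (auto simp: infdist_notempty cINF_less_iff[OF _ bdd_below_image_dist])
      then have "(norm (f - w))\<^sup>2 \<le> (sqrt (d\<^sup>2 + inverse (Suc n)))\<^sup>2"
        by (intro power_mono) (auto simp: dist_norm)
      with \<open>w \<in> W\<close> show ?thesis
        by (auto simp: F_def)
    qed
    show "m \<le> n \<Longrightarrow> F n \<subseteq> F m" for m n
      by (auto simp: F_def intro: order_trans le_imp_inverse_le)
    show "\<exists>n. \<forall>x\<in>F n. \<forall>y\<in>F n. dist x y < e" if "e > 0" for e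
    proof -
      obtain n where n: "inverse (real (Suc n)) < e\<^sup>2 / 4"
        using reals_Archimedean[of "e\<^sup>2 / 4"] \<open>e > 0\<close> by auto
      have "dist x y < e" if "x \<in> F n" "y \<in> F n" for x y
        using close[OF that] n \<open>e > 0\<close> by (intro power2_less_imp_less[of _ e]) auto
      then show ?thesis by blast
    qed
  qed blast
  have "g \<in> W" using g[of 0] by (simp add: F_def)
  have "(norm (f - g))\<^sup>2 \<le> d\<^sup>2"
  proof (rule field_le_epsilon)
    fix e :: real assume "e > 0"
    then obtain n where "inverse (real (Suc n)) < e"
      using reals_Archimedean by blast
    with g[of n] show "(norm (f - g))\<^sup>2 \<le> d\<^sup>2 + e"
      by (simp add: F_def)
  qed
  have "ip (f - g) w = 0" if "w \<in> W" for w
  proof (cases "w = 0")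
    case False
    let ?c = "ip (f - g) w / of_real ((norm w)\<^sup>2)"
    have "g + scl ?c w \<in> W"
      using sub \<open>g \<in> W\<close> that by (intro subspace_add subspace_scale)
    then have "d\<^sup>2 \<le> (norm (f - (g + scl ?c w)))\<^sup>2"
      by (intro power_mono d \<open>d \<ge> 0\<close>)
    also have "f - (g + scl ?c w) = f - g - scl ?c w" by simp
    also have "(norm (f - g - scl ?c w))\<^sup>2 = (norm (f - g))\<^sup>2 - (norm (ip (f - g) w))\<^sup>2 / (norm w)\<^sup>2"
      by (rule norm_subtract_component[OF False])
    finally have "(norm (ip (f - g) w))\<^sup>2 / (norm w)\<^sup>2 \<le> 0"
      using \<open>(norm (f - g))\<^sup>2 \<le> d\<^sup>2\<close> by linarith
    then show ?thesis
      using False by (simp add: divide_le_0_iff)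
  qed simp
  with \<open>g \<in> W\<close> show ?thesis by blast
qed

lemma orth_proj_unique:
  assumes "closed_subspace scl W" "g \<in> W" "\<And>w. w \<in> W \<Longrightarrow> ip (f - g) w = 0"
  shows "orth_proj ip W f = g"
  unfolding orth_proj_def
proof (rule the_equality)
  show "g \<in> W \<and> (\<forall>w\<in>W. ip (f - g) w = 0)"
    using assms by blast
next
  fix h assume h: "h \<in> W \<and> (\<forall>w\<in>W. ip (f - h) w = 0)"
  have "g - h \<in> W"
    using assms h by (auto simp: closed_subspace_def intro: subspace_diff)
  then have "ip (f - h) (g - h) = 0" "ip (f - g) (g - h) = 0"
    using h assms by auto
  then have "ip (g - h) (g - h) = 0"
    by (simp add: ip_diff_left)
  then show "h = g"
    using ip_self_eq_0 by fastforce
qed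

lemma
  assumes "closed_subspace scl W"
  shows orth_proj_in: "orth_proj ip W f \<in> W"
    and orth_proj_orth: "w \<in> W \<Longrightarrow> ip (f - orth_proj ip W f) w = 0"
  using ex_orth_proj[OF assms, of f] orth_proj_unique[OF assms] by auto

lemma orth_proj_self_adjoint:
  assumes "closed_subspace scl W"
  shows "ip (orth_proj ip W x) y = ip x (orth_proj ip W y)"
proof -
  have "ip (x - orth_proj ip W x) (orth_proj ip W y) = 0"
    using assms by (intro orth_proj_orth orth_proj_in)
  moreover have "ip (orth_proj ip W x) (y - orth_proj ip W y) = 0"
    using assms by (intro ip_zero_commute[OF orth_proj_orth] orth_proj_in)
  ultimately show ?thesis
    by (simp add: ip_diff_left ip_diff_right)
qed

lemma orth_proj_ident: "closed_subspace scl W \<Longrightarrow> f \<in> W \<Longrightarrow> orth_proj ip W f = f"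
  by (rule orth_proj_unique) auto

lemma norm_orth_proj_le:
  assumes "closed_subspace scl W"
  shows "norm (orth_proj ip W f) \<le> norm f"
proof -
  let ?p = "orth_proj ip W f"
  have "ip ?p ?p = ip f ?p"
    using orth_proj_orth[OF assms orth_proj_in[OF assms], of f f] by (simp add: ip_diff_left)
  then have "(norm ?p)\<^sup>2 = norm (ip f ?p)"
    by (metis norm_ip_self)
  also have "\<dots> \<le> norm f * norm ?p"
    by (rule Cauchy_Schwarz)
  finally show ?thesis
    by (cases "?p = 0") (auto simp: power2_eq_square)
qed

lemma
  assumes "closed_subspace scl W"
  shows orth_proj_add: "orth_proj ip W (x + y) = orth_proj ip W x + orth_proj ip W y"
    and orth_proj_scl: "orth_proj ip W (scl c x) = scl c (orth_proj ip W x)"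
proof -
  have sub: "subspace W"
    using assms by (simp add: closed_subspace_def)
  show "orth_proj ip W (x + y) = orth_proj ip W x + orth_proj ip W y"
  proof (rule orth_proj_unique[OF assms])
    show "ip (x + y - (orth_proj ip W x + orth_proj ip W y)) w = 0" if "w \<in> W" for w
      using orth_proj_orth[OF assms that, of x] orth_proj_orth[OF assms that, of y]
      by (simp add: ip_diff_left ip_add_left)
  qed (intro subspace_add sub orth_proj_in assms)
  show "orth_proj ip W (scl c x) = scl c (orth_proj ip W x)"
  proof (rule orth_proj_unique[OF assms])
    show "ip (scl c x - scl c (orth_proj ip W x)) w = 0" if "w \<in> W" for w
      using orth_proj_orth[OF assms that, of x]
      by (simp add: ip_diff_left ip_smult_left)
  qed (intro subspace_scale sub orth_proj_in assms)
qed

section \<open>Adjoints\<close>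

lemma ip_right_cancel:
  assumes "\<And>x. ip x y = ip x z"
  shows "y = z"
proof -
  have "ip (y - z) (y - z) = 0"
    using assms by (simp add: ip_diff_right)
  then show ?thesis
    using ip_self_eq_0 by fastforce
qed

text \<open>
  The kernel of a nonzero functional \<open>\<phi>\<close> is a closed hyperplane; a vector \<open>e\<close> orthogonal to it
  represents \<open>\<phi>\<close> after scaling, because every \<open>x\<close> differs from a multiple of \<open>e\<close> by an
  element of the kernel.
\<close>

lemma Riesz_representation:
  assumes "bounded_linear \<phi>" and scl: "\<And>c x. \<phi> (scl c x) = c * \<phi> x"
  shows "\<exists>u. \<forall>x. \<phi> x = ip x u"
proof (cases "\<forall>x. \<phi> x = 0")
  case True
  then show ?thesis by (intro exI[of _ 0]) simp
next
  case False
  interpret \<phi>: bounded_linear \<phi> by fact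
  define N where "N = {x. \<phi> x = 0}"
  have "closed N"
    unfolding N_def by (intro closed_Collect_eq \<phi>.continuous_on continuous_intros)
  moreover have "subspace N"
    by (auto simp: subspace_def N_def \<phi>.add \<phi>.zero scl)
  ultimately have N: "closed_subspace scl N"
    by (simp add: closed_subspace_def)
  obtain z where z: "\<phi> z \<noteq> 0" using False by blast
  define e where "e = z - orth_proj ip N z"
  have "\<phi> (orth_proj ip N z) = 0"
    using orth_proj_in[OF N] by (auto simp: N_def)
  then have e: "\<phi> e \<noteq> 0"
    using z by (simp add: e_def \<phi>.diff)
  then have e0: "ip e e \<noteq> 0"
    using ip_self_eq_0 \<phi>.zero by metis
  have "\<phi> x = ip x (scl (hconj (\<phi> e / ip e e)) e)" for x
  proof -
    have "x - scl (\<phi> x / \<phi> e) e \<in> N"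
      using e by (simp add: N_def \<phi>.diff scl)
    then have "ip e (x - scl (\<phi> x / \<phi> e) e) = 0"
      unfolding e_def by (intro orth_proj_orth N)
    then have "ip (x - scl (\<phi> x / \<phi> e) e) e = 0"
      by (rule ip_zero_commute)
    then show ?thesis
      using e e0 by (simp add: ip_diff_left ip_smult_left ip_smult_right hconj_hconj field_simps)
  qed
  then show ?thesis by blast
qed

lemma hadjoint_unique:
  assumes "\<And>x y. ip (T x) y = ip x (S y)"
  shows "hadjoint ip T = S"
  unfolding hadjoint_def
proof (rule the_equality)
  show "R = S" if "\<forall>x y. ip (T x) y = ip x (R y)" for R
    using that assms by (intro ext ip_right_cancel) metis
qed (use assms in blast)

lemma ip_hadjoint:
  assumes "bounded_operator scl T"
  shows "ip (T x) y = ip x (hadjoint ip T y)"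
proof -
  have "bounded_linear T" and T: "\<And>c x. T (scl c x) = scl c (T x)"
    using assms by (auto simp: bounded_operator_def)
  have "\<exists>u. \<forall>x. ip (T x) y = ip x u" for y
    by (rule Riesz_representation)
      (simp_all add: T ip_smult_left bounded_linear_compose[OF bounded_linear_ip_left \<open>bounded_linear T\<close>])
  then obtain S where S: "\<And>x y. ip (T x) y = ip x (S y)" by metis
  then have "hadjoint ip T = S"
    by (rule hadjoint_unique)
  with S show ?thesis by simp
qed

lemma hadjoint_ip:
  assumes "bounded_operator scl T"
  shows "ip (hadjoint ip T y) x = ip y (T x)"
  using ip_hadjoint[OF assms] by (metis ip_commute)

lemma bounded_operatorI:
  assumes "\<And>x y. T (x + y) = T x + T y" "\<And>c x. T (scl c x) = scl c (T x)"
    and "\<And>x. norm (T x) \<le> norm x * M"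
  shows "bounded_operator scl T"
  unfolding bounded_operator_def
proof (intro conjI allI bounded_linear_intro)
  show "T (r *\<^sub>R x) = r *\<^sub>R T x" for r x
    by (metis assms(2) smult_of_real)
qed (fact assms)+

lemma bounded_operator_hadjoint:
  assumes "bounded_operator scl T"
  shows "bounded_operator scl (hadjoint ip T)"
proof (rule bounded_operatorI)
  let ?S = "hadjoint ip T"
  have T: "bounded_linear T" using assms by (simp add: bounded_operator_def)
  show "?S (x + y) = ?S x + ?S y" for x y
    by (rule ip_right_cancel) (simp add: ip_add_right flip: ip_hadjoint[OF assms])
  show "?S (scl c x) = scl c (?S x)" for c x
    by (rule ip_right_cancel) (simp add: ip_smult_right flip: ip_hadjoint[OF assms])
  show "norm (?S x) \<le> norm x * onorm T" for x
  proof -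
    have "ip (?S x) (?S x) = ip (T (?S x)) x"
      by (simp add: ip_hadjoint[OF assms])
    then have "(norm (?S x))\<^sup>2 = norm (ip (T (?S x)) x)"
      by (metis norm_ip_self)
    also have "\<dots> \<le> norm (T (?S x)) * norm x"
      by (rule Cauchy_Schwarz)
    also have "\<dots> \<le> (onorm T * norm (?S x)) * norm x"
      by (intro mult_right_mono onorm T) simp
    finally show ?thesis
      by (cases "?S x = 0") (auto simp: power2_eq_square algebra_simps onorm_pos_le T)
  qed
qed

lemma closed_subspace_range:
  assumes "bounded_operator scl T" "closed (range T)"
  shows "closed_subspace scl (range T)"
proof -
  interpret T: bounded_linear T using assms by (simp add: bounded_operator_def)
  have T: "scl c (T x) = T (scl c x)" for c x
    using assms by (simp add: bounded_operator_def)
  have "subspace (range T)"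
    unfolding subspace_def
    by (auto simp: T image_iff simp flip: T.add intro: exI[of _ 0] T.zero[symmetric])
  then show ?thesis
    using assms by (simp add: closed_subspace_def)
qed

end

section \<open>Uniform boundedness\<close>

text \<open>
  The closed sets of points at which the whole family is bounded by \<open>n\<close> cover the space, so by
  Baire's theorem one of them contains a ball; linearity carries the bound from there to the origin.
\<close>

theorem uniform_boundedness:
  fixes \<Phi> :: "('a::banach \<Rightarrow> 'b::real_normed_vector) set"
  assumes lin: "\<And>\<phi>. \<phi> \<in> \<Phi> \<Longrightarrow> bounded_linear \<phi>"
    and ptw: "\<And>x. \<exists>M. \<forall>\<phi>\<in>\<Phi>. norm (\<phi> x) \<le> M"
  shows "\<exists>M. \<forall>\<phi>\<in>\<Phi>. \<forall>x. norm (\<phi> x) \<le> M * norm x"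
proof -
  define F where "F n = (\<Inter>\<phi>\<in>\<Phi>. {x. norm (\<phi> x) \<le> real n})" for n
  have closed: "closed (F n)" for n
    unfolding F_def
    by (intro closed_INT ballI closed_Collect_le continuous_on_norm linear_continuous_on lin continuous_intros)
  have "x \<in> \<Union>(range F)" for x
  proof -
    obtain M where "\<forall>\<phi>\<in>\<Phi>. norm (\<phi> x) \<le> M" using ptw by blast
    moreover obtain n where "M \<le> real n" using real_arch_simple by blast
    ultimately have "x \<in> F n" by (fastforce simp: F_def)
    then show ?thesis by blast
  qed
  then have "\<Union>(range F) = UNIV" by blast
  moreover have "euclidean interior_of \<Union>(range F) = {}" if "\<And>n. interior (F n) = {}"
    by (rule Baire_category_alt)
      (use closed that in \<open>auto simp: completely_metrizable_space_euclidean\<close>)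
  ultimately obtain n where "interior (F n) \<noteq> {}"
    by (metis interior_of_topspace topspace_euclidean UNIV_not_empty)
  then obtain x0 e where "e > 0" and ball: "cball x0 e \<subseteq> F n"
    by (meson ex_in_conv mem_interior_cball)
  have bound: "norm (\<phi> x) \<le> (2 * real n / e) * norm x" if "\<phi> \<in> \<Phi>" for \<phi> x
  proof (cases "x = 0")
    case True
    interpret \<phi>: bounded_linear \<phi> by (rule lin) fact
    show ?thesis using True by (simp add: \<phi>.zero)
  next
    case False
    interpret \<phi>: bounded_linear \<phi> by (rule lin) fact
    let ?y = "(e / norm x) *\<^sub>R x"
    have "x0 \<in> F n" "x0 + ?y \<in> F n"
      using ball \<open>e > 0\<close> False by (auto simp: dist_norm intro!: subsetD[OF ball])
    then have "norm (\<phi> x0) \<le> n" "norm (\<phi> (x0 + ?y)) \<le> n"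
      using that by (auto simp: F_def)
    then have "norm (\<phi> (x0 + ?y) - \<phi> x0) \<le> 2 * real n"
      using norm_triangle_ineq4[of "\<phi> (x0 + ?y)" "\<phi> x0"] by linarith
    then have "e / norm x * norm (\<phi> x) \<le> 2 * real n"
      using \<open>e > 0\<close> by (simp add: \<phi>.add \<phi>.scaleR)
    then show ?thesis
      using \<open>e > 0\<close> False by (simp add: field_simps)
  qed
  then show ?thesis by blast
qed

section \<open>Operators with closed range\<close>

context hilbert_space
begin

text \<open>
  For \<open>f\<close> in the range with \<open>\<parallel>T\<^sup>* f\<parallel> \<le> 1\<close>, the functionals \<open>\<langle>-, f\<rangle>\<close> are pointwise bounded:
  projecting \<open>x\<close> to the range as \<open>T z\<close> gives \<open>\<langle>x, f\<rangle> = \<langle>T z, f\<rangle> = \<langle>z, T\<^sup>* f\<rangle>\<close>, of modulus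
  at most \<open>\<parallel>z\<parallel>\<close>.  So they are uniformly bounded, that is, these \<open>f\<close> form a bounded set.
\<close>

lemma norm_le_hadjoint_on_closed_range:
  assumes T: "bounded_operator scl T" and cl: "closed (range T)"
  shows "\<exists>M>0. \<forall>f\<in>range T. norm f \<le> M * norm (hadjoint ip T f)"
proof -
  let ?S = "hadjoint ip T" and ?P = "orth_proj ip (range T)"
  have R: "closed_subspace scl (range T)"
    by (rule closed_subspace_range[OF T cl])
  interpret S: bounded_linear ?S
    using bounded_operator_hadjoint[OF T] by (simp add: bounded_operator_def)
  define \<Phi> where "\<Phi> = {\<lambda>x. ip x f |f. f \<in> range T \<and> norm (?S f) \<le> 1}"
  have "\<exists>M. \<forall>\<phi>\<in>\<Phi>. \<forall>x. norm (\<phi> x) \<le> M * norm x"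
  proof (rule uniform_boundedness)
    show "bounded_linear \<phi>" if "\<phi> \<in> \<Phi>" for \<phi>
      using that by (auto simp: \<Phi>_def bounded_linear_ip_left)
    show "\<exists>M. \<forall>\<phi>\<in>\<Phi>. norm (\<phi> x) \<le> M" for x
    proof -
      obtain z where z: "?P x = T z"
        using orth_proj_in[OF R] by blast
      have "norm (ip x f) \<le> norm z" if f: "f \<in> range T" "norm (?S f) \<le> 1" for f
      proof -
        have "ip x f = ip (?P x) f"
          using orth_proj_orth[OF R f(1), of x] by (simp add: ip_diff_left)
        also have "\<dots> = ip z (?S f)"
          by (simp add: z ip_hadjoint[OF T])
        finally have "norm (ip x f) \<le> norm z * norm (?S f)"
          by (simp add: Cauchy_Schwarz)
        also have "\<dots> \<le> norm z * 1"
          using f by (intro mult_left_mono) auto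
        finally show ?thesis by simp
      qed
      then show ?thesis by (auto simp: \<Phi>_def)
    qed
  qed
  then obtain M where M: "\<And>f x. f \<in> range T \<Longrightarrow> norm (?S f) \<le> 1 \<Longrightarrow> norm (ip x f) \<le> M * norm x"
    by (auto simp: \<Phi>_def)
  \<comment> \<open>the maximum makes the constant positive also when the range is trivial\<close>
  have "norm f \<le> max M 1 * norm (?S f)" if f: "f \<in> range T" for f
  proof (cases "?S f = 0")
    case True
    obtain z where "f = T z" using f by blast
    then have "ip f f = ip z (?S f)"
      by (simp add: ip_hadjoint[OF T])
    then have "f = 0"
      using True by (simp add: ip_self_eq_0)
    then show ?thesis by simp
  next
    case False
    define g where "g = (1 / norm (?S f)) *\<^sub>R f"
    have "g \<in> range T"
      unfolding g_def using f R by (intro subspace_scaleR) (auto simp: closed_subspace_def)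
    moreover have "norm (?S g) \<le> 1"
      using False by (simp add: g_def S.scaleR)
    ultimately have "norm (ip g g) \<le> M * norm g"
      by (rule M)
    then have "norm g * norm g \<le> M * norm g"
      by (simp add: ip_self norm_power power2_eq_square norm_mult)
    then have "norm g \<le> max M 1"
      by (cases "g = 0") auto
    then show ?thesis
      using False by (simp add: g_def divide_simps)
  qed
  then show ?thesis
    by (intro exI[of _ "max M 1"]) auto
qed

text \<open>
  On the range of \<open>T\<close> the operator \<open>T T\<^sup>*\<close> is bounded below, so its image \<open>V\<close> is closed.  An element
  \<open>h\<close> of the range orthogonal to \<open>V\<close> has \<open>\<parallel>T\<^sup>* h\<parallel>\<^sup>2 = \<langle>h, T T\<^sup>* h\<rangle> = 0\<close> and hence vanishes,
  so \<open>V\<close> is the whole range.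
\<close>

lemma range_operator_hadjoint_on_closed_range:
  assumes T: "bounded_operator scl T" and cl: "closed (range T)" and y: "y \<in> range T"
  shows "\<exists>f\<in>range T. T (hadjoint ip T f) = y"
proof -
  let ?S = "hadjoint ip T"
  have R: "closed_subspace scl (range T)"
    by (rule closed_subspace_range[OF T cl])
  then have sub: "subspace (range T)"
    by (simp add: closed_subspace_def)
  interpret T: bounded_linear T
    using T by (simp add: bounded_operator_def)
  interpret S: bounded_linear ?S
    using bounded_operator_hadjoint[OF T] by (simp add: bounded_operator_def)
  have Tscl: "T (scl c x) = scl c (T x)" "?S (scl c x) = scl c (?S x)" for c x
    using T bounded_operator_hadjoint[OF T] by (auto simp: bounded_operator_def)
  obtain M where "M > 0" and M: "\<And>f. f \<in> range T \<Longrightarrow> norm f \<le> M * norm (?S f)"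
    using norm_le_hadjoint_on_closed_range[OF T cl] by blast
  define V where "V = (\<lambda>f. T (?S f)) ` range T"
  have lower: "1 / M\<^sup>2 * norm f \<le> norm (T (?S f))" if "f \<in> range T" for f
  proof -
    have "ip (?S f) (?S f) = ip (T (?S f)) f"
      by (simp add: ip_hadjoint[OF T])
    then have "(norm (?S f))\<^sup>2 = norm (ip (T (?S f)) f)"
      by (metis norm_ip_self)
    also have "\<dots> \<le> norm (T (?S f)) * norm f"
      by (rule Cauchy_Schwarz)
    finally have *: "(norm (?S f))\<^sup>2 \<le> norm (T (?S f)) * norm f" .
    have "(norm f)\<^sup>2 \<le> M\<^sup>2 * (norm (?S f))\<^sup>2"
      using power_mono[OF M[OF that], of 2] by (simp add: power_mult_distrib)
    also have "\<dots> \<le> M\<^sup>2 * (norm (T (?S f)) * norm f)"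
      by (intro mult_left_mono *) simp
    finally have "norm f \<le> M\<^sup>2 * norm (T (?S f))"
      by (cases "f = 0") (auto simp: power2_eq_square)
    then show ?thesis
      using \<open>M > 0\<close> by (simp add: field_simps)
  qed
  have "complete V"
    unfolding V_def
  proof (rule complete_isometric_image)
    show "0 < 1 / M\<^sup>2" using \<open>M > 0\<close> by simp
    show "Real_Vector_Spaces.subspace (range T)"
      by (auto simp: Real_Vector_Spaces.subspace_def intro: subspace_scaleR[OF sub] subspace_add[OF sub] subspace_0[OF sub])
    show "bounded_linear (\<lambda>f. T (?S f))"
      by (intro bounded_linear_compose[OF T.bounded_linear] S.bounded_linear)
    show "\<forall>x\<in>range T. 1 / M\<^sup>2 * norm x \<le> norm (T (?S x))"
      using lower by blast
    show "complete (range T)"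
      using cl by (simp add: complete_eq_closed)
  qed
  moreover have "subspace V"
    unfolding V_def
  proof (rule subspaceI)
    show "0 \<in> (\<lambda>f. T (?S f)) ` range T"
      using subspace_0[OF sub] by (auto intro!: image_eqI[of _ _ 0] simp: T.zero S.zero)
    fix x y c assume "x \<in> (\<lambda>f. T (?S f)) ` range T"
    then obtain a where a: "a \<in> range T" "x = T (?S a)" by blast
    then have "scl c x = T (?S (scl c a))" "scl c a \<in> range T"
      by (auto simp: Tscl intro: subspace_scale[OF sub])
    then show "scl c x \<in> (\<lambda>f. T (?S f)) ` range T" by blast
    assume "y \<in> (\<lambda>f. T (?S f)) ` range T"
    then obtain b where b: "b \<in> range T" "y = T (?S b)" by blast
    then have "x + y = T (?S (a + b))" "a + b \<in> range T"
      using a by (auto simp: T.add S.add intro: subspace_add[OF sub])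
    then show "x + y \<in> (\<lambda>f. T (?S f)) ` range T" by blast
  qed
  ultimately have V: "closed_subspace scl V"
    by (simp add: closed_subspace_def complete_eq_closed)
  define h where "h = y - orth_proj ip V y"
  have "orth_proj ip V y \<in> V"
    by (rule orth_proj_in[OF V])
  moreover have "V \<subseteq> range T"
    by (auto simp: V_def)
  ultimately have h: "h \<in> range T"
    unfolding h_def by (intro subspace_diff[OF sub] y) auto
  then have "T (?S h) \<in> V"
    by (auto simp: V_def)
  then have "ip h (T (?S h)) = 0"
    using orth_proj_orth[OF V, of "T (?S h)" y] by (simp only: h_def)
  then have "ip (?S h) (?S h) = 0"
    by (simp add: hadjoint_ip[OF T])
  then have "?S h = 0"
    by (rule ip_self_eq_0)
  then have "h = 0"
    using M[OF h] by simp
  then have "y \<in> V"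
    using \<open>orth_proj ip V y \<in> V\<close> by (simp add: h_def)
  then show ?thesis
    by (auto simp: V_def)
qed

section \<open>The pseudo-inverse\<close>

text \<open>
  For each \<open>y\<close> there is exactly one \<open>G y\<close> in the range with \<open>T (T\<^sup>* (G y)) = P y\<close>, where \<open>P\<close> is
  the projection onto the range; the pseudo-inverse is \<open>y \<mapsto> T\<^sup>* (G y)\<close>.  Then
  \<open>T \<circ> X = P\<close>, and \<open>X\<close> is bounded because
  \<open>\<parallel>X y\<parallel>\<^sup>2 = \<langle>G y, P y\<rangle> \<le> \<parallel>G y\<parallel> \<parallel>y\<parallel> \<le> M \<parallel>X y\<parallel> \<parallel>y\<parallel>\<close>.
\<close>

lemma pseudo_inverse_exists:
  assumes T: "bounded_operator scl T" and cl: "closed (range T)"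
  shows "\<exists>X. bounded_operator scl X \<and> T \<circ> X \<circ> T = T \<and> X \<circ> T \<circ> X = X \<and>
           hadjoint ip (T \<circ> X) = T \<circ> X \<and> hadjoint ip (X \<circ> T) = X \<circ> T"
proof -
  let ?S = "hadjoint ip T" and ?P = "orth_proj ip (range T)"
  have R: "closed_subspace scl (range T)"
    by (rule closed_subspace_range[OF T cl])
  then have sub: "subspace (range T)"
    by (simp add: closed_subspace_def)
  interpret T: bounded_linear T
    using T by (simp add: bounded_operator_def)
  interpret S: bounded_linear ?S
    using bounded_operator_hadjoint[OF T] by (simp add: bounded_operator_def)
  have Tscl: "T (scl c x) = scl c (T x)" "?S (scl c x) = scl c (?S x)" for c x
    using T bounded_operator_hadjoint[OF T] by (auto simp: bounded_operator_def)
  obtain M where "M > 0" and M: "\<And>f. f \<in> range T \<Longrightarrow> norm f \<le> M * norm (?S f)"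
    using norm_le_hadjoint_on_closed_range[OF T cl] by blast
  have "\<forall>y. \<exists>f\<in>range T. T (?S f) = ?P y"
    by (intro allI range_operator_hadjoint_on_closed_range[OF T cl] orth_proj_in[OF R])
  then obtain G where G_in: "\<And>y. G y \<in> range T" and G: "\<And>y. T (?S (G y)) = ?P y"
    by metis
  have inj: "f = g" if "f \<in> range T" "g \<in> range T" "T (?S f) = T (?S g)" for f g
  proof -
    have "ip (?S (f - g)) (?S (f - g)) = ip (T (?S (f - g))) (f - g)"
      by (simp add: ip_hadjoint[OF T])
    also have "\<dots> = 0"
      using that by (simp add: S.diff T.diff)
    finally have "?S (f - g) = 0"
      by (rule ip_self_eq_0)
    then show ?thesis
      using M[OF subspace_diff[OF sub that(1,2)]] by simp
  qed
  define X where "X y = ?S (G y)" for y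
  have TX: "T (X y) = ?P y" for y
    by (simp add: X_def G)
  have X_ip: "ip (X a) z = ip (G a) (T z)" for a z
    by (simp add: X_def hadjoint_ip[OF T])
  have "bounded_operator scl X"
  proof (rule bounded_operatorI)
    show "X (x + y) = X x + X y" for x y
    proof -
      have "G (x + y) = G x + G y"
        by (rule inj) (simp_all add: G_in subspace_add[OF sub] S.add T.add G orth_proj_add[OF R])
      then show ?thesis by (simp add: X_def S.add)
    qed
    show "X (scl c x) = scl c (X x)" for c x
    proof -
      have "G (scl c x) = scl c (G x)"
        by (rule inj) (simp_all add: G_in subspace_scale[OF sub] Tscl G orth_proj_scl[OF R])
      then show ?thesis by (simp add: X_def Tscl)
    qed
    show "norm (X x) \<le> norm x * M" for x
    proof -
      have "ip (X x) (X x) = ip (G x) (?P x)"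
        by (simp add: X_ip TX)
      then have "(norm (X x))\<^sup>2 = norm (ip (G x) (?P x))"
        by (metis norm_ip_self)
      also have "\<dots> \<le> norm (G x) * norm (?P x)"
        by (rule Cauchy_Schwarz)
      also have "\<dots> \<le> (M * norm (X x)) * norm x"
        unfolding X_def using \<open>M > 0\<close>
        by (intro mult_mono M G_in norm_orth_proj_le R) auto
      finally show ?thesis
        using \<open>M > 0\<close> by (cases "X x = 0") (auto simp: power2_eq_square algebra_simps)
    qed
  qed
  moreover have "T \<circ> X \<circ> T = T"
    by (auto simp: TX orth_proj_ident[OF R])
  moreover have "X (?P y) = X y" for y
  proof -
    have "G (?P y) = G y"
      by (rule inj) (simp_all add: G_in G orth_proj_ident[OF R] orth_proj_in[OF R])
    then show ?thesis by (simp add: X_def)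
  qed
  then have "X \<circ> T \<circ> X = X"
    by (auto simp: TX)
  moreover have "hadjoint ip (T \<circ> X) = T \<circ> X"
    by (rule hadjoint_unique) (simp add: TX orth_proj_self_adjoint[OF R])
  moreover have "hadjoint ip (X \<circ> T) = X \<circ> T"
  proof (rule hadjoint_unique)
    fix x y
    have "ip (X (T x)) y = ip (G (T x)) (T (X (T y)))"
      by (simp add: X_ip TX orth_proj_ident[OF R])
    also have "\<dots> = ip (T (X (T x))) (G (T y))"
      by (simp add: X_def hadjoint_ip[OF T] ip_hadjoint[OF T])
    also have "\<dots> = ip (T x) (G (T y))"
      by (simp add: TX orth_proj_ident[OF R])
    also have "\<dots> = ip x (X (T y))"
      by (simp add: X_def ip_hadjoint[OF T])
    finally show "ip ((X \<circ> T) x) y = ip x ((X \<circ> T) y)" by simp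
  qed
  ultimately show ?thesis by blast
qed

text \<open>
  The equations \<open>P Q = Q\<close> and \<open>Q P = P\<close> say that two projections have the same range; then
  \<open>P = P\<^sup>* = (Q P)\<^sup>* = P Q = Q\<close>.
\<close>

lemma self_adjoint_idempotent_eqI:
  assumes P: "\<And>x y. ip (P x) y = ip x (P y)" and Q: "\<And>x y. ip (Q x) y = ip x (Q y)"
    and "\<And>x. P (Q x) = Q x" "\<And>x. Q (P x) = P x"
  shows "P = Q"
proof
  fix y
  have "ip x (P y) = ip x (Q y)" for x
    by (metis assms)
  then show "P y = Q y" by (rule ip_right_cancel)
qed

lemma bounded_operator_comp:
  assumes "bounded_operator scl T" "bounded_operator scl X"
  shows "bounded_operator scl (T \<circ> X)"
  using assms by (simp add: bounded_operator_def o_def bounded_linear_compose)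

text \<open>
  Both \<open>T X\<close> and \<open>T Y\<close> are the projection onto the range of \<open>T\<close>, and both \<open>X T\<close> and \<open>Y T\<close> are the
  projection along its kernel; so \<open>X = X T X = X T Y = Y T Y = Y\<close>.
\<close>

lemma pseudo_inverse_unique:
  assumes T: "bounded_operator scl T"
    and X: "bounded_operator scl X" "T \<circ> X \<circ> T = T" "X \<circ> T \<circ> X = X"
      "hadjoint ip (T \<circ> X) = T \<circ> X" "hadjoint ip (X \<circ> T) = X \<circ> T"
    and Y: "bounded_operator scl Y" "T \<circ> Y \<circ> T = T" "Y \<circ> T \<circ> Y = Y"
      "hadjoint ip (T \<circ> Y) = T \<circ> Y" "hadjoint ip (Y \<circ> T) = Y \<circ> T"
  shows "X = Y"
proof -
  have sa: "ip (Z x) y = ip x (Z y)" if "bounded_operator scl Z" "hadjoint ip Z = Z" for Z x y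
    using ip_hadjoint[OF that(1)] that(2) by simp
  have "T \<circ> X = T \<circ> Y"
  proof (rule self_adjoint_idempotent_eqI)
    show "(T \<circ> X) ((T \<circ> Y) x) = (T \<circ> Y) x" "(T \<circ> Y) ((T \<circ> X) x) = (T \<circ> X) x" for x
      using fun_cong[OF X(2)] fun_cong[OF Y(2)] by auto
  qed (intro sa bounded_operator_comp T X Y)+
  moreover
  have XT: "ip ((X \<circ> T) x) y = ip x ((X \<circ> T) y)" and YT: "ip ((Y \<circ> T) x) y = ip x ((Y \<circ> T) y)" for x y
    by (intro sa bounded_operator_comp T X Y)+
  have "X \<circ> T = Y \<circ> T"
  proof
    fix y
    have "ip x (X (T y)) = ip x (Y (T y))" for x
    proof -
      have "ip x (X (T y)) = ip (X (T (Y (T x)))) y"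
        using XT[of x y] fun_cong[OF Y(2), of x] by simp
      also have "\<dots> = ip x (Y (T (X (T y))))"
        using XT[of "Y (T x)" y] YT[of x "X (T y)"] by simp
      also have "\<dots> = ip x (Y (T y))"
        using fun_cong[OF X(2), of y] by simp
      finally show ?thesis .
    qed
    then show "(X \<circ> T) y = (Y \<circ> T) y"
      by (auto intro: ip_right_cancel)
  qed
  ultimately show ?thesis
    using X(3) Y(3) by (metis comp_assoc)
qed

lemma
  assumes "bounded_operator scl T" "closed (range T)"
  shows bounded_operator_pseudo_inverse: "bounded_operator scl (pseudo_inverse scl ip T)"
    and pseudo_inverse_right: "f \<in> range T \<Longrightarrow> T (pseudo_inverse scl ip T f) = f"
proof -
  let ?X = "pseudo_inverse scl ip T"
  have *: "bounded_operator scl ?X \<and> T \<circ> ?X \<circ> T = T \<and> ?X \<circ> T \<circ> ?X = ?X \<and>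
      hadjoint ip (T \<circ> ?X) = T \<circ> ?X \<and> hadjoint ip (?X \<circ> T) = ?X \<circ> T"
    unfolding pseudo_inverse_def
    by (rule theI'[OF ex_ex1I[OF pseudo_inverse_exists[OF assms]]])
      (elim conjE, rule pseudo_inverse_unique[OF assms(1)]; assumption)
  then show "bounded_operator scl ?X" by blast
  show "T (?X f) = f" if "f \<in> range T"
    using * that by (metis comp_apply rangeE)
qed

text \<open>
  On the range, \<open>\<parallel>f\<parallel>\<^sup>2 = \<langle>T (X f), f\<rangle> = \<langle>X f, T\<^sup>* f\<rangle>\<close>, to which the Cauchy--Schwarz inequality
  applies.
\<close>

lemma norm_le_pseudo_inverse_hadjoint:
  assumes T: "bounded_operator scl T" and cl: "closed (range T)" and f: "f \<in> range T"
  shows "norm f \<le> onorm (pseudo_inverse scl ip T) * norm (hadjoint ip T f)"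
proof -
  let ?X = "pseudo_inverse scl ip T"
  have X: "bounded_linear ?X"
    using bounded_operator_pseudo_inverse[OF T cl] by (simp add: bounded_operator_def)
  have "ip f f = ip (?X f) (hadjoint ip T f)"
    using pseudo_inverse_right[OF T cl f] by (simp flip: ip_hadjoint[OF T])
  then have "(norm f)\<^sup>2 = norm (ip (?X f) (hadjoint ip T f))"
    by (metis norm_ip_self)
  also have "\<dots> \<le> norm (?X f) * norm (hadjoint ip T f)"
    by (rule Cauchy_Schwarz)
  also have "\<dots> \<le> (onorm ?X * norm f) * norm (hadjoint ip T f)"
    by (intro mult_right_mono onorm X) simp
  finally show ?thesis
    by (cases "f = 0") (auto simp: power2_eq_square algebra_simps onorm_pos_le X)
qed

end

section \<open>Deleting members of a fusion frame\<close>

theorem theorem3p4: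
  fixes scl :: "'k::hilbert_scalar \<Rightarrow> 'h::banach \<Rightarrow> 'h"
    and ip :: "'h \<Rightarrow> 'h \<Rightarrow> 'k"
    and K :: "'h \<Rightarrow> 'h"
    and I J :: "'i set"
    and W :: "'i \<Rightarrow> 'h set"
    and v :: "'i \<Rightarrow> real"
    and A B C :: real
  assumes "hilbert_space scl ip"
    and "separable_space (euclidean :: 'h topology)"
    and "bounded_operator scl K"
    and "closed (range K)"
    and "countable I"
    and "K_fusion_frame_on scl ip K UNIV I W v A B"
    and "J \<subseteq> I"
    and "((\<lambda>i. (v i)\<^sup>2) has_sum C) J"
    and "A - C * (onorm (pseudo_inverse scl ip K))\<^sup>2 > 0"
  shows "K_fusion_frame_on scl ip K (range K) (I - J) W v
           (A - C * (onorm (pseudo_inverse scl ip K))\<^sup>2) B"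
  unfolding K_fusion_frame_on_def
proof (intro conjI ballI)
  interpret hilbert_space scl ip by fact
  let ?N = "onorm (pseudo_inverse scl ip K)" and ?S = "hadjoint ip K"
  have W: "closed_subspace scl (W i)" if "i \<in> I" for i
    using assms(6) that by (simp add: K_fusion_frame_on_def)
  show "0 < A - C * ?N\<^sup>2" "0 < B"
    using assms by (simp_all add: K_fusion_frame_on_def)
  show "closed_subspace scl (W i)" if "i \<in> I - J" for i
    using W that by simp
  fix f assume f: "f \<in> range K"
  define a where "a i = (v i)\<^sup>2 * (norm (orth_proj ip (W i) f))\<^sup>2" for i
  have summ: "a summable_on I" and lower: "A * (norm (?S f))\<^sup>2 \<le> infsum a I"
    and upper: "infsum a I \<le> B * (norm f)\<^sup>2"
    using assms(6) by (auto simp: K_fusion_frame_on_def a_def[abs_def])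
  have a0: "a i \<ge> 0" for i by (simp add: a_def)
  have summJ: "a summable_on J"
    using summ \<open>J \<subseteq> I\<close> by (rule summable_on_subset_banach)
  have diff: "infsum a (I - J) = infsum a I - infsum a J"
    by (rule infsum_Diff[OF summ summJ \<open>J \<subseteq> I\<close>])
  have "C \<ge> 0"
    by (rule has_sum_nonneg[OF assms(8)]) simp
  have "infsum a J \<le> C * (norm f)\<^sup>2"
  proof (rule has_sum_mono[OF has_sum_infsum[OF summJ] has_sum_cmult_left[OF assms(8)]])
    show "a i \<le> (v i)\<^sup>2 * (norm f)\<^sup>2" if "i \<in> J" for i
      unfolding a_def using W that \<open>J \<subseteq> I\<close>
      by (intro mult_left_mono power_mono norm_orth_proj_le) auto
  qed
  also have "\<dots> \<le> C * (?N * norm (?S f))\<^sup>2"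
    using \<open>C \<ge> 0\<close>
    by (intro mult_left_mono power_mono norm_le_pseudo_inverse_hadjoint assms f) auto
  finally have J: "infsum a J \<le> C * ?N\<^sup>2 * (norm (?S f))\<^sup>2"
    by (simp add: power_mult_distrib)
  show "(\<lambda>i. (v i)\<^sup>2 * (norm (orth_proj ip (W i) f))\<^sup>2) summable_on I - J"
    using summable_on_subset_banach[OF summ, of "I - J"] by (auto simp: a_def[abs_def])
  have "(A - C * ?N\<^sup>2) * (norm (?S f))\<^sup>2 \<le> infsum a (I - J)"
    using J lower by (simp add: diff algebra_simps)
  then show "(A - C * ?N\<^sup>2) * (norm (?S f))\<^sup>2
      \<le> (\<Sum>\<^sub>\<infinity>i\<in>I - J. (v i)\<^sup>2 * (norm (orth_proj ip (W i) f))\<^sup>2)"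
    by (simp add: a_def[abs_def])
  have "infsum a (I - J) \<le> B * (norm f)\<^sup>2"
    using upper infsum_nonneg[of J a] a0 by (simp add: diff)
  then show "(\<Sum>\<^sub>\<infinity>i\<in>I - J. (v i)\<^sup>2 * (norm (orth_proj ip (W i) f))\<^sup>2) \<le> B * (norm f)\<^sup>2"
    by (simp add: a_def[abs_def])
qed

end
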